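(* Let $N\ge 1$ and let $g\in\mathbb{C}^N$ satisfy $\langle g,g_{p,\ell}\rangle\neq 0$ for $p=0,1$ and all $\ell\in\mathbb{Z}_N$. Then the Gabor frame $G=(g_\lambda)_{\lambda\in\mathbb{Z}_N^2}$ allows phase retrieval for the class $\mathcal{C}_f$ of all non-vanishing signals in $\mathbb{C}^N$.
   Context: Vectors in $\mathbb{C}^N$ are indexed by $\mathbb{Z}_N=\mathbb{Z}/N\mathbb{Z}$, and $\omega=e^{2\pi i/N}$. The scalar product is $\langle x,y\rangle=\sum_{j\in\mathbb{Z}_N}\overline{x(j)}\,y(j)$. Translations and modulations are $(T_px)(n)=x(n-p)$ and $(M_\ell x)(n)=\omega^{\ell n}x(n)$ for $p,\ell\in\mathbb{Z}_N$. For $\lambda=(p,\ell)\in\mathbb{Z}_N^2$ put $g_\lambda=g_{p,\ell}=M_\ell T_pg$. A vector $x\in\mathbb{C}^N$ is non-vanishing if $x(n)\neq0$ for all $n\in\mathbb{Z}_N$; $\mathcal{C}_f$ is the set of all non-vanishing vectors. Let $\mathbb{T}=\{c\in\mathbb{C}:|c|=1\}$. For a class $\mathcal{C}\subseteq\mathbb{C}^N$ and $\Lambda\subseteq\mathbb{Z}_N^2$, the system $(g_\lambda)_{\lambda\in\Lambda}$ allows phase retrieval for $\mathcal{C}$ if the map $x\mapsto(|\langle x,g_\lambda\rangle|^2)_{\lambda\in\Lambda}$ is injective on $\mathcal{C}/\mathbb{T}$; i.e. whenever $x,y\in\mathcal{C}$ satisfy $|\langle x,g_\lambda\rangle|=|\langle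 y,g_\lambda\rangle|$ for all $\lambda\in\Lambda$, there is $c\in\mathbb{T}$ with $x=cy$. *)

theory Defs
  imports "HOL-Analysis.Analysis" "Berlekamp_Zassenhaus.Finite_Field"
begin

text \<open>
  The ring \<open>\<int>/N\<int>\<close> is the type \<open>'n mod_ring\<close>, where \<open>N = CARD('n) \<ge> 1\<close> for a finite type
  \<open>'n\<close>, and signals are vectors of type \<open>complex ^ 'n mod_ring\<close>. Since \<open>N = 1\<close> is allowed,
  \<open>'n mod_ring\<close> need not be of class \<open>comm_ring_1\<close>; the residue class of 1 is therefore
  written \<open>of_int_mod_ring 1\<close>.
\<close>

text \<open>Conjugate-linear in the first argument.\<close>

definition complex_inner :: "complex ^ 'i::finite \<Rightarrow> complex ^ 'i \<Rightarrow> complex" where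
  "complex_inner x y = (\<Sum>j\<in>UNIV. cnj (x $ j) * y $ j)"

definition translation ::
    "'n::finite mod_ring \<Rightarrow> complex ^ 'n mod_ring \<Rightarrow> complex ^ 'n mod_ring" where
  "translation p x = (\<chi> n. x $ (n - p))"

text \<open>
  The exponent is the product of the representatives in \<open>{0..<N}\<close>; as the base is an \<open>N\<close>-th
  root of unity, the value does not depend on the choice of representatives.
\<close>

definition modulation ::
    "'n::finite mod_ring \<Rightarrow> complex ^ 'n mod_ring \<Rightarrow> complex ^ 'n mod_ring" where
  "modulation l x =
     (\<chi> n. exp (2 * complex_of_real pi * \<i> / of_nat CARD('n))
             powi (to_int_mod_ring l * to_int_mod_ring n) * x $ n)"

definition gabor ::
    "complex ^ 'n::finite mod_ring \<Rightarrow> 'n mod_ring \<times> 'n mod_ring \<Rightarrow> complex ^ 'n mod_ring" where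
  "gabor g = (\<lambda>(p, l). modulation l (translation p g))"

definition non_vanishing :: "(complex ^ 'i::finite) set" where
  "non_vanishing = {x. \<forall>n. x $ n \<noteq> 0}"

text \<open>
  Injectivity of \<open>x \<mapsto> (|\<langle>x, f k\<rangle>|\<^sup>2)\<^sub>k\<close> on \<open>C\<close> modulo multiplication by unimodular scalars.
\<close>

definition allows_phase_retrieval ::
    "'k set \<Rightarrow> ('k \<Rightarrow> complex ^ 'i::finite) \<Rightarrow> (complex ^ 'i) set \<Rightarrow> bool" where
  "allows_phase_retrieval \<Lambda> f C \<longleftrightarrow>
     (\<forall>x\<in>C. \<forall>y\<in>C.
        (\<forall>k\<in>\<Lambda>. (cmod (complex_inner x (f k)))\<^sup>2 = (cmod (complex_inner y (f k)))\<^sup>2) \<longrightarrow>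
        (\<exists>c. cmod c = 1 \<and> x = c *s y))"

end

theory Submission
  imports Defs
begin

text \<open>
  Write \<open>N = CARD('n)\<close> and \<open>\<chi>\<^sub>l(n) = \<omega>\<^bsup>ln\<^esup>\<close>. For fixed \<open>p\<close>, expanding \<open>|\<langle>x, g\<^sub>p\<^sub>,\<^sub>l\<rangle>|\<^sup>2\<close> as a double
  sum and collecting the terms by the difference \<open>k\<close> of the two summation indices exhibits it, as
  a function of \<open>l\<close>, as the Fourier transform of
  \<open>k \<mapsto> \<Sum>\<^sub>m (cnj (x(m + k)) x(m)) (g(m + k - p) cnj (g(m - p)))\<close>. The Fourier transform on
  \<open>\<int>/N\<int>\<close> is injective, so the measurements determine, for every lag \<open>k\<close>, the correlation of the
  lag product \<open>m \<mapsto> cnj (x(m + k)) x(m)\<close> of the signal with the lag product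
  \<open>m \<mapsto> g(m + k) cnj (g(m))\<close> of the window. For \<open>k = -p\<close> the Fourier transform of the latter is
  \<open>l \<mapsto> \<langle>g, g\<^sub>p\<^sub>,\<^sub>l\<rangle>\<close>; if it has no zeros, the correlation can be inverted and the lag product of
  \<open>x\<close> itself is determined (\<open>lag_product_eq_of_spectrogram_eq\<close>).

  With \<open>p = 0\<close> this recovers every \<open>|x(m)|\<close>, and with \<open>p = 1\<close> every product
  \<open>cnj (x(m - 1)) x(m)\<close>, that is, all phase differences between neighbouring entries. As no entry
  vanishes, these phases propagate through the whole cycle \<open>\<int>/N\<int>\<close>, since it is generated by 1,
  and \<open>x\<close> is determined up to one global phase (\<open>unimodular_multiple_of_lag_products_eq\<close>).
\<close>

section \<open>The characters of the cyclic group\<close>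

definition character :: "'n::finite mod_ring \<Rightarrow> 'n mod_ring \<Rightarrow> complex" where
  "character l n = exp (2 * complex_of_real pi * \<i> / of_nat CARD('n))
                     powi (to_int_mod_ring l * to_int_mod_ring n)"

lemma unity_root_powi:
  "exp (2 * complex_of_real pi * \<i> / of_nat N) powi k = cis (2 * pi * of_int k / of_nat N)"
  by (simp add: exp_power_int cis_conv_exp mult_ac)

lemma unity_root_powi_cong:
  assumes "[a = b] (mod int N)"
  shows "exp (2 * complex_of_real pi * \<i> / of_nat N) powi a
       = exp (2 * complex_of_real pi * \<i> / of_nat N) powi b"
proof (cases "N = 0")
  case True
  then show ?thesis by simp
next
  case False
  obtain k where k: "b = a + int N * k"
    using assms by (auto simp: cong_iff_lin)
  have "2 * pi * of_int b / real N = 2 * pi * of_int a / real N + 2 * pi * of_int k"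
    using False by (simp add: k field_simps)
  then show ?thesis
    by (simp add: unity_root_powi cis_mult[symmetric] cis_multiple_2pi)
qed

lemma to_int_mod_ring_add:
  "[to_int_mod_ring (a + b) = to_int_mod_ring a + to_int_mod_ring b] (mod int CARD('n))"
  for a b :: "'n::finite mod_ring"
  unfolding cong_def by transfer simp

lemma character_add_right: "character l (m + n) = character l m * character l n"
proof -
  have "[to_int_mod_ring l * to_int_mod_ring (m + n)
       = to_int_mod_ring l * to_int_mod_ring m + to_int_mod_ring l * to_int_mod_ring n]
         (mod int CARD('a))"
    by (metis cong_scalar_left distrib_left to_int_mod_ring_add)
  then show ?thesis
    unfolding character_def
    by (subst power_int_add[symmetric]) (auto intro: unity_root_powi_cong)
qed

lemma character_commute: "character l n = character n l"
  by (simp add: character_def mult.commute)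

lemma character_add_left: "character (k + l) n = character k n * character l n"
  using character_add_right[of n k l] by (simp add: character_commute)

lemma character_zero_right [simp]: "character l 0 = 1"
  by (simp add: character_def)

lemma norm_character [simp]: "norm (character l n) = 1"
  by (simp add: character_def unity_root_powi)

lemma character_minus_right: "character l (- n) = cnj (character l n)"
proof -
  have "character l (- n) * character l n = 1"
    using character_add_right[of l "- n" n] by simp
  moreover have "cnj (character l n) * character l n = 1"
    using complex_norm_square[of "character l n"] by (simp add: mult.commute)
  moreover have "character l n \<noteq> 0"
    using norm_character[of l n] by force
  ultimately show ?thesis
    by (metis mult_right_cancel)
qed

lemma character_minus_left: "character (- l) n = cnj (character l n)"
  using character_minus_right[of n l] by (simp add: character_commute)

text \<open>
  The frequency \<open>l = 1\<close> already separates \<open>n\<close> from 0, because the representative of \<open>n\<close> lies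
  strictly between 0 and \<open>N\<close>.
\<close>

lemma character_nontrivial:
  fixes n :: "'n::finite mod_ring"
  assumes "n \<noteq> 0"
  shows "\<exists>l. character l n \<noteq> 1"
proof -
  define r where "r = to_int_mod_ring n"
  have "r \<noteq> 0"
    using assms by (simp add: r_def)
  moreover have r_bounds: "0 \<le> r" "r < int CARD('n)"
    using range_to_int_mod_ring[where ?'a = 'n] by (auto simp: r_def set_eq_iff)
  ultimately have "r > 0" by simp
  have "to_int_mod_ring (of_int_mod_ring 1 :: 'n mod_ring) = 1"
    using \<open>r > 0\<close> r_bounds by simp
  then have char_1: "character (of_int_mod_ring 1) n = cis (2 * pi * of_int r / real CARD('n))"
    by (simp add: character_def unity_root_powi r_def)
  have "cis (2 * pi * of_int r / real CARD('n)) \<noteq> 1"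
  proof
    assume "cis (2 * pi * of_int r / real CARD('n)) = 1"
    then obtain k :: int where "2 * pi * of_int r / real CARD('n) = of_int (2 * k) * pi"
      by (auto simp: cis_conv_exp exp_eq_1)
    then have "real_of_int r = real_of_int (k * int CARD('n))"
      by (simp add: field_simps)
    then have "r = k * int CARD('n)"
      by linarith
    then show False
      using \<open>r > 0\<close> r_bounds by (metis dvd_triv_right zdvd_not_zless)
  qed
  with char_1 show ?thesis by metis
qed

lemma sum_shift: "(\<Sum>n\<in>UNIV. f (n + a)) = sum f UNIV"
  for a :: "'a::{finite, ab_group_add}"
  by (rule sum.reindex_bij_witness[of _ "\<lambda>n. n - a" "\<lambda>n. n + a"]) auto

text \<open>
  Shifting the summation index multiplies the sum by a value of the character, which can be
  chosen different from 1 when \<open>n \<noteq> 0\<close>.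
\<close>

lemma sum_character:
  fixes n :: "'n::finite mod_ring"
  shows "(\<Sum>l\<in>UNIV. character l n) = (if n = 0 then of_nat CARD('n) else 0)"
proof (cases "n = 0")
  case False
  then obtain k where "character k n \<noteq> 1"
    using character_nontrivial by blast
  moreover have "(\<Sum>l\<in>UNIV. character l n) = (\<Sum>l\<in>UNIV. character l n) * character k n"
    using sum_shift[of "\<lambda>l. character l n" k]
    by (simp add: character_add_left sum_distrib_right)
  ultimately show ?thesis
    using False by simp
qed simp

text \<open>
  Orthogonality of the characters recovers \<open>N D(m)\<close> as a combination of the Fourier
  coefficients.
\<close>

lemma fourier_injective:
  fixes D :: "'n::finite mod_ring \<Rightarrow> complex"
  assumes "\<And>l. (\<Sum>n\<in>UNIV. character l n * D n) = 0"
  shows "D m = 0"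
proof -
  have "0 = (\<Sum>l\<in>UNIV. character l (- m) * (\<Sum>n\<in>UNIV. character l n * D n))"
    by (simp add: assms)
  also have "\<dots> = (\<Sum>l\<in>UNIV. \<Sum>n\<in>UNIV. character l (n - m) * D n)"
    by (simp add: sum_distrib_left mult_ac character_add_right flip: add_uminus_conv_diff)
  also have "\<dots> = (\<Sum>n\<in>UNIV. (\<Sum>l\<in>UNIV. character l (n - m)) * D n)"
    by (subst sum.swap) (simp add: sum_distrib_right)
  also have "\<dots> = of_nat CARD('n) * D m"
    by (simp add: sum_character if_distrib[where f = "\<lambda>c. c * _"] cong: if_cong)
  finally show ?thesis by simp
qed

text \<open>
  The Fourier transform turns a correlation into a product, so a function whose transform has
  no zeros has vanishing correlation only with the zero function.
\<close>

lemma correlation_injective: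
  fixes D G :: "'n::finite mod_ring \<Rightarrow> complex"
  assumes corr: "\<And>q. (\<Sum>m\<in>UNIV. D m * G (m - q)) = 0"
    and G: "\<And>l. (\<Sum>m\<in>UNIV. character l m * G m) \<noteq> 0"
  shows "D m = 0"
proof (rule fourier_injective)
  fix l :: "'n mod_ring"
  have reflect: "(\<Sum>q\<in>UNIV. character (- l) (- q) * G (m - q))
      = character l m * (\<Sum>j\<in>UNIV. character (- l) j * G j)" for m
  proof -
    have "(\<Sum>q\<in>UNIV. character (- l) (- q) * G (m - q))
        = (\<Sum>j\<in>UNIV. character (- l) (j - m) * G j)"
      by (rule sum.reindex_bij_witness[of _ "\<lambda>j. m - j" "\<lambda>q. m - q"]) auto
    also have "\<dots> = character l m * (\<Sum>j\<in>UNIV. character (- l) j * G j)"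
      by (simp add: sum_distrib_left mult_ac character_add_right character_minus_right
          character_minus_left flip: add_uminus_conv_diff)
    finally show ?thesis .
  qed
  have "0 = (\<Sum>q\<in>UNIV. character (- l) (- q) * (\<Sum>m\<in>UNIV. D m * G (m - q)))"
    by (simp add: corr)
  also have "\<dots> = (\<Sum>m\<in>UNIV. D m * (\<Sum>q\<in>UNIV. character (- l) (- q) * G (m - q)))"
    by (simp add: sum_distrib_left mult_ac) (rule sum.swap)
  also have "\<dots> = (\<Sum>m\<in>UNIV. character l m * D m) * (\<Sum>j\<in>UNIV. character (- l) j * G j)"
    by (simp only: reflect) (simp add: sum_distrib_right mult_ac)
  finally show "(\<Sum>m\<in>UNIV. character l m * D m) = 0"
    using G[of "- l"] by simp
qed

section \<open>Lag products from the measurements\<close>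

lemma complex_inner_gabor:
  "complex_inner x (gabor g (p, l)) = (\<Sum>n\<in>UNIV. character l n * (cnj (x $ n) * g $ (n - p)))"
  by (simp add: complex_inner_def gabor_def modulation_def translation_def character_def mult_ac)

text \<open>
  In the double sum for the squared modulus the character only sees the difference \<open>k\<close> of the
  two indices, so that grouping by \<open>k\<close> yields a Fourier transform in \<open>l\<close>.
\<close>

lemma spectrogram_eq_fourier:
  "complex_of_real ((cmod (complex_inner x (gabor g (p, l))))\<^sup>2) =
     (\<Sum>k\<in>UNIV. character l k *
        (\<Sum>m\<in>UNIV. (cnj (x $ (m + k)) * x $ m) * (g $ (m + k - p) * cnj (g $ (m - p)))))"
proof -
  define F where "F n = cnj (x $ n) * g $ (n - p)" for n
  have "complex_of_real ((cmod (complex_inner x (gabor g (p, l))))\<^sup>2)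
      = (\<Sum>m\<in>UNIV. (\<Sum>n\<in>UNIV. character l n * F n) * cnj (character l m * F m))"
    unfolding complex_norm_square complex_inner_gabor F_def
    by (simp only: sum_distrib_left cnj_sum)
  also have "\<dots> = (\<Sum>m\<in>UNIV. (\<Sum>k\<in>UNIV. character l (k + m) * F (k + m)) * cnj (character l m * F m))"
    by (simp only: sum_shift[of "\<lambda>n. character l n * F n"])
  also have "\<dots> = (\<Sum>m\<in>UNIV. \<Sum>k\<in>UNIV. character l k * (F (m + k) * cnj (F m)))"
  proof (simp only: sum_distrib_right, intro sum.cong refl)
    fix m k
    have "character l (k + m) * cnj (character l m) = character l k"
      using character_add_right[of l "k + m" "- m"] by (simp add: character_minus_right)
    then show "character l (k + m) * F (k + m) * cnj (character l m * F m)
        = character l k * (F (m + k) * cnj (F m))"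
      by (metis (no_types, opaque_lifting) add.commute complex_cnj_mult mult.assoc mult.left_commute)
  qed
  also have "\<dots> = (\<Sum>k\<in>UNIV. \<Sum>m\<in>UNIV. character l k * (F (m + k) * cnj (F m)))"
    by (rule sum.swap)
  finally show ?thesis
    by (simp add: F_def sum_distrib_left mult_ac)
qed

text \<open>
  The difference of the two lag products at lag \<open>-p\<close> has vanishing correlation with
  \<open>m \<mapsto> g(m - p) cnj (g(m))\<close>, whose Fourier transform is \<open>l \<mapsto> \<langle>g, g\<^sub>p\<^sub>,\<^sub>l\<rangle>\<close>; it is
  therefore zero.
\<close>

lemma lag_product_eq_of_spectrogram_eq:
  fixes g x y :: "complex ^ 'n::finite mod_ring"
  assumes eq: "\<And>q l. (cmod (complex_inner x (gabor g (q, l))))\<^sup>2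
                    = (cmod (complex_inner y (gabor g (q, l))))\<^sup>2"
    and g: "\<And>l. complex_inner g (gabor g (p, l)) \<noteq> 0"
  shows "cnj (x $ (m - p)) * x $ m = cnj (y $ (m - p)) * y $ m"
proof -
  define H where "H z k q =
      (\<Sum>m\<in>UNIV. (cnj (z $ (m + k)) * z $ m) * (g $ (m + k - q) * cnj (g $ (m - q))))"
    for z and k q :: "'n mod_ring"
  have H_eq: "H x k q = H y k q" for k q
  proof -
    have "(\<Sum>k\<in>UNIV. character l k * (H x k q - H y k q)) = 0" for l
      using spectrogram_eq_fourier[of x g q l] spectrogram_eq_fourier[of y g q l] eq[of q l]
      by (simp add: H_def right_diff_distrib sum_subtractf)
    then have "H x k q - H y k q = 0"
      by (rule fourier_injective)
    then show ?thesis by simp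
  qed
  define D where "D m = cnj (x $ (m - p)) * x $ m - cnj (y $ (m - p)) * y $ m" for m
  define G where "G m = cnj (g $ m) * g $ (m - p)" for m
  have "D m = 0"
  proof (rule correlation_injective)
    fix q
    have "(\<Sum>m\<in>UNIV. D m * G (m - q)) = H x (- p) q - H y (- p) q"
      unfolding H_def D_def G_def sum_subtractf[symmetric]
      by (intro sum.cong refl) (simp add: algebra_simps)
    then show "(\<Sum>m\<in>UNIV. D m * G (m - q)) = 0"
      by (simp add: H_eq)
  next
    fix l
    show "(\<Sum>m\<in>UNIV. character l m * G m) \<noteq> 0"
      using g[of l] by (simp add: complex_inner_gabor G_def)
  qed
  then show ?thesis by (simp add: D_def)
qed

section \<open>Phase propagation\<close>

lemma mod_ring_induct_one:
  fixes n :: "'n::finite mod_ring"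
  assumes zero: "P 0" and step: "\<And>m. P m \<Longrightarrow> P (m + of_int_mod_ring 1)"
  shows "P n"
proof -
  have "P (of_int_mod_ring (int k))" for k
  proof (induction k)
    case (Suc k)
    have "of_int_mod_ring (int (Suc k)) = (of_int_mod_ring (int k) + of_int_mod_ring 1 :: 'n mod_ring)"
      by transfer (simp add: mod_simps add.commute)
    with step[OF Suc] show ?case by simp
  qed (simp add: zero)
  moreover have "0 \<le> to_int_mod_ring n"
    by transfer simp
  ultimately show ?thesis
    by (metis nonneg_int_cases of_int_mod_ring_to_int_mod_ring)
qed

text \<open>
  The quotient \<open>x(m)/y(m)\<close> is unimodular, so the equality of the products at lag 1 says exactly
  that it does not change from \<open>m\<close> to \<open>m + 1\<close>.
\<close>

lemma unimodular_multiple_of_lag_products_eq: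
  fixes x y :: "complex ^ 'n::finite mod_ring"
  assumes y: "\<And>m. y $ m \<noteq> 0"
    and modulus: "\<And>m. cnj (x $ m) * x $ m = cnj (y $ m) * y $ m"
    and phase: "\<And>m. cnj (x $ (m - of_int_mod_ring 1)) * x $ m
                   = cnj (y $ (m - of_int_mod_ring 1)) * y $ m"
  shows "\<exists>c. cmod c = 1 \<and> x = c *s y"
proof -
  define c where "c = x $ 0 / y $ 0"
  have "(cmod (x $ m))\<^sup>2 = (cmod (y $ m))\<^sup>2" for m
  proof -
    have "complex_of_real ((cmod (x $ m))\<^sup>2) = complex_of_real ((cmod (y $ m))\<^sup>2)"
      unfolding complex_norm_square using modulus[of m] by (simp add: mult.commute)
    then show ?thesis
      by (simp only: of_real_eq_iff)
  qed
  then have "cmod (x $ m) = cmod (y $ m)" for m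
    by (simp add: power2_eq_iff_nonneg)
  then have c: "cmod c = 1"
    using y by (simp add: c_def norm_divide)
  then have cnj_c: "cnj c * c = 1"
    using complex_norm_square[of c] by (simp add: mult.commute)
  have "x $ m = c * y $ m" for m
  proof (induction m rule: mod_ring_induct_one)
    case 1
    show ?case using y by (simp add: c_def)
  next
    case (2 m)
    have "cnj (y $ m) * (cnj c * x $ (m + of_int_mod_ring 1))
        = cnj (y $ m) * y $ (m + of_int_mod_ring 1)"
      using phase[of "m + of_int_mod_ring 1"] 2 by (simp add: mult_ac)
    then have "cnj c * x $ (m + of_int_mod_ring 1) = y $ (m + of_int_mod_ring 1)"
      using y by simp
    then show ?case
      using cnj_c by (metis mult.assoc mult.commute mult_1)
  qed
  then have "x = c *s y"
    by (simp add: vec_eq_iff)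
  with c show ?thesis by blast
qed

theorem theorem2p4:
  fixes g :: "complex ^ 'n::finite mod_ring"
  assumes "\<And>p l. p \<in> {0, of_int_mod_ring 1} \<Longrightarrow> complex_inner g (gabor g (p, l)) \<noteq> 0"
  shows "allows_phase_retrieval (UNIV :: ('n mod_ring \<times> 'n mod_ring) set) (gabor g) non_vanishing"
  unfolding allows_phase_retrieval_def
proof (intro ballI impI)
  fix x y :: "complex ^ 'n mod_ring"
  assume y: "y \<in> non_vanishing"
    and eq: "\<forall>k\<in>UNIV. (cmod (complex_inner x (gabor g k)))\<^sup>2 = (cmod (complex_inner y (gabor g k)))\<^sup>2"
  have lag: "cnj (x $ (m - p)) * x $ m = cnj (y $ (m - p)) * y $ m"
    if "p \<in> {0, of_int_mod_ring 1}" for p m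
    using eq assms[OF that] by (intro lag_product_eq_of_spectrogram_eq[of x g y p]) auto
  show "\<exists>c. cmod c = 1 \<and> x = c *s y"
  proof (rule unimodular_multiple_of_lag_products_eq)
    show "y $ m \<noteq> 0" for m
      using y by (simp add: non_vanishing_def)
    show "cnj (x $ m) * x $ m = cnj (y $ m) * y $ m" for m
      using lag[of 0 m] by simp
    show "cnj (x $ (m - of_int_mod_ring 1)) * x $ m = cnj (y $ (m - of_int_mod_ring 1)) * y $ m" for m
      by (rule lag) simp
  qed
qed

end
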